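(* For any positive integers $n$ and $k$, if $n < k^2+2k+3$, then $\varGamma(n;k)=\emptyset$.
   Context: All graphs are simple, finite and undirected. The circumference $c(G)$ of a graph $G$ is the number of vertices in a longest cycle of $G$. A graph is Hamiltonian if it contains a cycle through all of its vertices. For positive integers $n$ and $k$ with $n \ge k$, $\varGamma(n;k)$ denotes the set of all graphs $G$ of order $n$ such that $c(G)=n-k$ and every induced subgraph of $G$ with $n-k$ vertices is Hamiltonian. *)

theory Defs
  imports "Graph_Theory.Graph_Theory"
begin

text \<open>
  Finite simple undirected graphs are the finite, loop-free, symmetric pair digraphs
  (\<^locale>\<open>pair_graph\<close>): an undirected edge is represented by its two opposite arcs.
  Under this representation the library's notion of cycle admits the closed walk
  \<open>u, v, u\<close> along a single edge, so the length must be required to be at least 3.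
\<close>

definition graph_cycle :: "('a, 'b) pre_digraph \<Rightarrow> 'b list \<Rightarrow> bool" where
  "graph_cycle G p \<longleftrightarrow> pre_digraph.cycle G p \<and> 3 \<le> length p"

definition cycle_verts :: "('a, 'b) pre_digraph \<Rightarrow> 'b list \<Rightarrow> 'a set" where
  "cycle_verts G p = tail G ` set p"

definition hamiltonian :: "('a, 'b) pre_digraph \<Rightarrow> bool" where
  "hamiltonian G \<longleftrightarrow> (\<exists>p. graph_cycle G p \<and> cycle_verts G p = verts G)"

text \<open>The circumference of an acyclic graph is 0 by convention.\<close>

definition circumference :: "('a, 'b) pre_digraph \<Rightarrow> nat" where
  "circumference G = Max (insert 0 {card (cycle_verts G p) | p. graph_cycle G p})"

text \<open>
  The conditions ``equal to \<open>n - k\<close>'' are written additively because subtraction on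
  \<^typ>\<open>nat\<close> truncates; in particular no graph is a member if \<open>n < k\<close>.
\<close>

definition Gamma_class :: "nat \<Rightarrow> nat \<Rightarrow> 'a pair_pre_digraph set" where
  "Gamma_class n k = {G. pair_graph G \<and> card (pverts G) = n
      \<and> circumference (with_proj G) + k = n
      \<and> (\<forall>U. U \<subseteq> pverts G \<and> card U + k = n \<longrightarrow> hamiltonian (with_proj G \<restriction> U))}"

end

theory Submission
  imports Defs "HOL-Number_Theory.Cong"
begin

text \<open>
  A graph in the class has minimum degree at least \<open>k + 2\<close>, and every induced path on at most
  \<open>k + 1\<close> vertices extends to a longer one. So there is an induced path \<open>p\<^sub>0, \<dots>, p\<^sub>k\<^sub>-\<^sub>1\<close>; let \<open>C\<close> be
  a Hamiltonian cycle of the rest, which is a longest cycle of the graph. Two distinct vertices of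
  \<open>C\<close> adjacent to \<open>p\<^sub>i\<close> and \<open>p\<^sub>j\<close> have distance at least \<open>\<bar>i - j\<bar> + 2\<close> on \<open>C\<close>, for otherwise a
  detour along the path gives a longer cycle. A packing argument turns this into
  \<open>\<bar>C\<bar> \<ge> e + m\<close>, where \<open>e\<close> is the number of edges between the path and \<open>C\<close>, and \<open>m\<close> the number of
  vertices of \<open>C\<close> with a neighbour on the path. The degrees give \<open>e \<ge> k (k + 2) - 2 (k - 1)\<close> and
  \<open>m \<ge> k + 1\<close>, whence \<open>n = \<bar>C\<bar> + k \<ge> k\<^sup>2 + 2 k + 3\<close>.
\<close>

section \<open>Cycles as vertex lists\<close>

text \<open>The combinatorics needs only an adjacency relation. The first vertex is not repeated in
  the list, so rotating and splicing cycles are plain list operations.\<close>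

definition vertex_cycle :: "('a \<Rightarrow> 'a \<Rightarrow> bool) \<Rightarrow> 'a list \<Rightarrow> bool" where
  "vertex_cycle E xs \<longleftrightarrow> distinct xs \<and> 3 \<le> length xs \<and> successively E (xs @ [hd xs])"

lemma vertex_cycle_rotate1:
  assumes "vertex_cycle E xs"
  shows "vertex_cycle E (rotate1 xs)"
proof -
  obtain x y zs where "xs = x # y # zs"
    using assms by (cases xs; cases "tl xs") (auto simp: vertex_cycle_def)
  then have "successively E (y # zs @ [x])" "E x y"
    using assms by (auto simp: vertex_cycle_def)
  then have "successively E ((y # zs @ [x]) @ [y])"
    by (subst successively_append_iff) simp
  then show ?thesis
    using assms \<open>xs = _\<close> by (auto simp: vertex_cycle_def)
qed

lemma vertex_cycle_rotate: "vertex_cycle E xs \<Longrightarrow> vertex_cycle E (rotate n xs)"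
  by (induction n) (auto simp: vertex_cycle_rotate1)

lemma vertex_cycle_nth:
  assumes "vertex_cycle E xs" "i < length xs"
  shows "E (xs ! i) (xs ! (Suc i mod length xs))"
proof (cases "Suc i = length xs")
  case True
  moreover have "xs \<noteq> []"
    using assms(2) by auto
  moreover have "E ((xs @ [hd xs]) ! i) ((xs @ [hd xs]) ! length xs)"
    using assms True successively_nth[of E "xs @ [hd xs]" i] by (simp add: vertex_cycle_def)
  ultimately show ?thesis
    using assms(2) by (simp add: nth_append hd_conv_nth)
next
  case False
  then show ?thesis
    using assms successively_nth[of E "xs @ [hd xs]" i]
    by (auto simp: vertex_cycle_def nth_append)
qed

section \<open>Translation between arc cycles and vertex cycles\<close>

context pair_pre_digraph
begin

lemma pcas_verts: "pcas u p v \<Longrightarrow> pawalk_verts u p = u # map snd p \<and> map fst p @ [v] = u # map snd p"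
  by (induction p arbitrary: u) auto

lemma pcas_successively:
  "pcas u p v \<Longrightarrow> set p \<subseteq> parcs G \<Longrightarrow> successively (\<lambda>x y. (x, y) \<in> parcs G) (u # map snd p)"
  by (induction p arbitrary: u) (auto simp: successively_Cons)

lemma pcas_zip: "pcas x (zip (x # ys) (ys @ [v])) v"
  by (induction ys arbitrary: x) auto

lemma successively_zip:
  "successively (\<lambda>x y. (x, y) \<in> parcs G) (x # ys @ [v]) \<Longrightarrow> set (zip (x # ys) (ys @ [v])) \<subseteq> parcs G"
  by (induction ys arbitrary: x) auto

end

lemma graph_cycle_imp_vertex_cycle:
  assumes "graph_cycle (with_proj G \<restriction> U) p"
  obtains xs where "vertex_cycle (\<lambda>x y. (x, y) \<in> parcs G) xs"
    "set xs = cycle_verts (with_proj G \<restriction> U) p"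
proof
  interpret pair_pre_digraph G .
  let ?H = "with_proj G \<restriction> U"
  \<comment> \<open>Both functions depend only on the head and tail maps, which restriction to
    \<open>U\<close> preserves.\<close>
  have eqs: "pre_digraph.cas ?H = pcas" "pre_digraph.awalk_verts ?H = pawalk_verts"
  proof -
    show "pre_digraph.cas ?H = pcas"
    proof (intro ext)
      fix u es v show "pre_digraph.cas ?H u es v = pcas u es v"
        by (induct es arbitrary: u) (auto simp: pre_digraph.cas.simps)
    qed
    show "pre_digraph.awalk_verts ?H = pawalk_verts"
    proof (intro ext)
      fix u es show "pre_digraph.awalk_verts ?H u es = pawalk_verts u es"
        by (induct es arbitrary: u) (auto simp: pre_digraph.awalk_verts.simps)
    qed
  qed
  obtain u where u: "set p \<subseteq> parcs G" "pcas u p u" "distinct (tl (pawalk_verts u p))"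
    "p \<noteq> []" "3 \<le> length p"
    using assms by (auto simp: graph_cycle_def pre_digraph.cycle_def pre_digraph.awalk_def eqs)
  note verts = pcas_verts[OF u(2)]
  \<comment> \<open>Distinctness is given for the heads of the arcs, but the list consists of their
    tails; on a closed walk the two have the same multiset.\<close>
  have "mset (map fst p @ [u]) = mset (u # map snd p)"
    using verts by simp
  then have "mset (map fst p) = mset (map snd p)"
    by simp
  then have "distinct (map fst p)"
    using u(3) verts mset_eq_imp_distinct_iff by fastforce
  moreover have "hd (map fst p) = u"
    using verts u(4) by (cases p) auto
  ultimately show "vertex_cycle (\<lambda>x y. (x, y) \<in> parcs G) (map fst p)"
    using u pcas_successively[OF u(2,1)] verts by (simp add: vertex_cycle_def)
  show "set (map fst p) = cycle_verts ?H p"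
    by (simp add: cycle_verts_def)
qed

lemma (in pair_wf_digraph) vertex_cycle_imp_graph_cycle:
  assumes "vertex_cycle (\<lambda>x y. (x, y) \<in> parcs G) xs"
  obtains p where "graph_cycle (with_proj G) p" "cycle_verts (with_proj G) p = set xs"
proof -
  obtain x ys where xs: "xs = x # ys"
    using assms by (cases xs) (auto simp: vertex_cycle_def)
  \<comment> \<open>Each vertex is paired with its cyclic successor.\<close>
  define p where "p = zip (x # ys) (ys @ [x])"
  have len: "length p = length xs"
    by (simp add: p_def xs)
  have arcs: "set p \<subseteq> parcs G"
    using successively_zip assms unfolding p_def by (simp add: vertex_cycle_def xs)
  have cas: "pcas x p x"
    unfolding p_def by (rule pcas_zip)
  have fst_p: "map fst p = xs" and snd_p: "map snd p = ys @ [x]"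
    by (simp_all add: p_def xs del: zip_Cons_Cons)
  have "p \<noteq> []"
    by (simp add: p_def)
  then have "x \<in> pverts G"
    using arcs arc_fst_in_verts[of "hd p"] by (cases ys) (auto simp: p_def)
  then have "cycle p"
    unfolding cycle_def using arcs cas pcas_verts[OF cas] snd_p assms \<open>p \<noteq> []\<close>
    by (intro exI[of _ x]) (auto simp: awalk_def vertex_cycle_def xs)
  then have "graph_cycle (with_proj G) p"
    using assms len by (auto simp: graph_cycle_def vertex_cycle_def)
  moreover have "cycle_verts (with_proj G) p = set xs"
    by (simp add: cycle_verts_def flip: fst_p)
  ultimately show ?thesis
    using that by blast
qed

lemma (in pair_fin_digraph) vertex_cycle_le_circumference:
  assumes "vertex_cycle (\<lambda>x y. (x, y) \<in> parcs G) xs"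
  shows "length xs \<le> circumference (with_proj G)"
proof -
  obtain p where p: "graph_cycle (with_proj G) p" "cycle_verts (with_proj G) p = set xs"
    using vertex_cycle_imp_graph_cycle[OF assms] .
  \<comment> \<open>This bound makes the set of cycle orders finite, as \<open>Max\<close>
    requires.\<close>
  have "card (cycle_verts (with_proj G) q) \<le> card (pverts G)" if "graph_cycle (with_proj G) q" for q
  proof (intro card_mono pair_finite_verts)
    have "set q \<subseteq> parcs G"
      using that by (auto simp: graph_cycle_def cycle_def awalk_def)
    then show "cycle_verts (with_proj G) q \<subseteq> pverts G"
      unfolding cycle_verts_def with_proj_simps by (meson arc_fst_in_verts image_subsetI subsetD)
  qed
  then have "{card (cycle_verts (with_proj G) q) | q. graph_cycle (with_proj G) q}
      \<subseteq> {..card (pverts G)}"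
    by blast
  then have "finite {card (cycle_verts (with_proj G) q) | q. graph_cycle (with_proj G) q}"
    by (rule finite_subset) simp
  then have "card (cycle_verts (with_proj G) p) \<le> circumference (with_proj G)"
    unfolding circumference_def by (intro Max_ge) (use p(1) in simp_all, blast)
  moreover have "card (set xs) = length xs"
    using assms by (simp add: vertex_cycle_def distinct_card)
  ultimately show ?thesis
    using p(2) by simp
qed

section \<open>Graphs all of whose \<open>k\<close>-vertex-deleted subgraphs span a longest cycle\<close>

text \<open>Handshaking on the path \<open>0, ..., j\<close>, which has \<open>j\<close>
  edges.\<close>

lemma sum_path_degrees:
  "(\<Sum>i<Suc j. card {l. l < Suc j \<and> (i = Suc l \<or> l = Suc i)}) = 2 * j"
proof -
  have "{l. l < Suc j \<and> (i = Suc l \<or> l = Suc i)} =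
    (if 0 < i then {i - 1} else {}) \<union> (if i < j then {Suc i} else {})" if "i < Suc j" for i
    using that by auto
  then have "(\<Sum>i<Suc j. card {l. l < Suc j \<and> (i = Suc l \<or> l = Suc i)})
      = (\<Sum>i<Suc j. (if 0 < i then 1 else 0) + (if i < j then 1 else 0))"
    by (intro sum.cong) auto
  also have "\<dots> = (\<Sum>i<Suc j. if 0 < i then 1 else 0) + (\<Sum>i<Suc j. if i < j then 1 else 0)"
    by (rule sum.distrib)
  also have "(\<Sum>i<Suc j. if 0 < i then 1 else 0 :: nat) = j"
    by (induction j) auto
  also have "(\<Sum>i<Suc j. if i < j then 1 else 0 :: nat) = j"
    by simp
  finally show ?thesis
    by simp
qed

text \<open>The graph class in terms of adjacency. By \<open>cycle_bound\<close>, each cycle from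
  \<open>spanning_cycle\<close> is a longest cycle of the whole graph.\<close>

locale deletion_hamiltonian =
  fixes V :: "'a set" and E :: "'a \<Rightarrow> 'a \<Rightarrow> bool" and k :: nat
  assumes finite_V: "finite V"
    and sym: "E x y \<Longrightarrow> E y x"
    and irrefl: "\<not> E x x"
    and in_V: "E x y \<Longrightarrow> x \<in> V"
    and k_pos: "0 < k"
    and k_le: "k \<le> card V"
    and cycle_bound: "vertex_cycle E xs \<Longrightarrow> length xs + k \<le> card V"
    and spanning_cycle: "R \<subseteq> V \<Longrightarrow> card R = k \<Longrightarrow> \<exists>xs. vertex_cycle E xs \<and> set xs = V - R"
begin

lemma obtain_cycle:
  assumes "R \<subseteq> V" "card R = k"
  obtains xs where "vertex_cycle E xs" "set xs = V - R" "length xs + k = card V"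
proof -
  obtain xs where xs: "vertex_cycle E xs" "set xs = V - R"
    using spanning_cycle[OF assms] by blast
  have "length xs = card (V - R)"
    using xs by (metis distinct_card vertex_cycle_def)
  also have "\<dots> = card V - k"
    using assms finite_V by (metis card_Diff_subset finite_subset)
  finally show thesis
    using that[OF xs] k_le by simp
qed

lemma card_V_ge: "k + 3 \<le> card V"
proof -
  obtain R where "R \<subseteq> V" "card R = k"
    using k_le obtain_subset_with_card_n by metis
  then obtain xs where "vertex_cycle E xs" "length xs + k = card V"
    using obtain_cycle by metis
  then show ?thesis
    by (simp add: vertex_cycle_def)
qed

lemma finite_nbrs: "finite {w. E v w}"
  by (rule finite_subset[OF _ finite_V]) (use sym in_V in blast)

section \<open>Detours from a longest cycle\<close>

text \<open>Otherwise replace the \<open>d - 1\<close> inner vertices of the arc of length \<open>d\<close> by \<open>Q\<close>.\<close>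

lemma shortcut:
  assumes xs: "vertex_cycle E xs" "length xs + k = card V"
    and Q: "Q \<noteq> []" "distinct Q" "successively E Q" "set Q \<inter> set xs = {}"
    and t: "t < length xs" and d: "0 < d" "d < length xs"
    and ends: "E (xs ! t) (hd Q)" "E (last Q) (xs ! ((t + d) mod length xs))"
  shows "length Q + 1 \<le> d"
proof -
  define ys where "ys = rotate t xs"
  have ys: "vertex_cycle E ys" "set ys = set xs" "length ys = length xs"
    using xs(1) by (simp_all add: ys_def vertex_cycle_rotate)
  have "ys \<noteq> []"
    using d ys(3) by auto
  have hd_ys: "hd ys = xs ! t"
    using t d \<open>ys \<noteq> []\<close> by (simp add: hd_conv_nth ys_def nth_rotate)
  have hd_drop: "hd (drop d ys) = xs ! ((t + d) mod length xs)"
    using d ys(3) by (simp add: hd_drop_conv_nth) (simp add: ys_def nth_rotate)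
  \<comment> \<open>After the rotation \<open>hd ys\<close> is one end of the arc and
    \<open>drop d ys\<close> starts at the other; the closing edge is kept.\<close>
  define zs where "zs = hd ys # Q @ drop d ys"
  have "successively E (ys @ [hd ys])"
    using ys(1) by (simp add: vertex_cycle_def)
  then have "successively E (take d ys @ drop d ys @ [hd ys])"
    by (simp flip: append_assoc)
  then have "successively E (drop d ys @ [hd ys])"
    by (simp add: successively_append_iff)
  then have "successively E (zs @ [hd zs])"
    using Q d ys(3) ends hd_ys hd_drop
    by (auto simp: zs_def successively_Cons successively_append_iff)
  moreover have "distinct zs"
  proof -
    have "distinct ys"
      using ys(1) by (simp add: vertex_cycle_def)
    obtain y ys' where "ys = y # ys'"
      using \<open>ys \<noteq> []\<close> by (cases ys) auto
    moreover have "hd ys \<notin> set (drop d ys)"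
      using \<open>distinct ys\<close> d(1) \<open>ys = y # ys'\<close> by (cases d) (auto dest: in_set_dropD)
    moreover have "set (drop d ys) \<subseteq> set xs"
      using ys(2) set_drop_subset by metis
    ultimately show ?thesis
      using \<open>distinct ys\<close> Q(2,4) ys(2) by (auto simp: zs_def)
  qed
  moreover have "length zs = 1 + length Q + (length xs - d)"
    by (simp add: zs_def ys(3))
  moreover have "0 < length Q"
    using Q(1) by simp
  ultimately have "vertex_cycle E zs"
    using d unfolding vertex_cycle_def by linarith
  from cycle_bound[OF this] show ?thesis
    using xs(2) \<open>length zs = _\<close> d by simp
qed

section \<open>Minimum degree\<close>

lemma cycle_succ:
  assumes "vertex_cycle E xs" "x \<in> set xs"
  obtains t where "t < length xs" "xs ! t = x" "E x (xs ! ((t + 1) mod length xs))"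
  using assms vertex_cycle_nth by (metis Suc_eq_plus1 in_set_conv_nth)

text \<open>With \<open>v\<close> rotated to the front, its neighbours on the cycle are the second
  and the last entry, distinct because the length is at least 3.\<close>

lemma cycle_two_nbrs:
  assumes "vertex_cycle E xs" "v \<in> set xs"
  shows "2 \<le> card ({w. E v w} \<inter> set xs)"
proof -
  obtain t where t: "t < length xs" "xs ! t = v"
    using assms(2) by (metis in_set_conv_nth)
  define ys where "ys = rotate t xs"
  have ys: "vertex_cycle E ys" "set ys = set xs" "length ys = length xs"
    using assms(1) by (simp_all add: ys_def vertex_cycle_rotate)
  have len: "3 \<le> length ys"
    using ys(1) by (simp add: vertex_cycle_def)
  have "ys ! 0 = v"
    using t nth_rotate[of 0 xs t] by (cases "xs = []") (simp_all add: ys_def)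
  moreover have "E (ys ! 0) (ys ! 1)"
    using vertex_cycle_nth[OF ys(1), of 0] len by (cases "ys = []") simp_all
  moreover have "E (ys ! (length ys - 1)) (ys ! 0)"
    using vertex_cycle_nth[OF ys(1), of "length ys - 1"] len by (cases "length ys") simp_all
  moreover have "ys ! 1 \<noteq> ys ! (length ys - 1)"
    using ys(1) len by (simp add: vertex_cycle_def nth_eq_iff_index_eq)
  moreover have "ys ! 1 \<in> set xs" "ys ! (length ys - 1) \<in> set xs"
    using len ys(2) by (metis One_nat_def diff_less less_le_trans nth_mem zero_less_numeral
        zero_less_one one_less_numeral_iff semiring_norm(77))+
  ultimately have "{ys ! 1, ys ! (length ys - 1)} \<subseteq> {w. E v w} \<inter> set xs"
    using sym by auto
  from card_mono[OF _ this] show ?thesis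
    using \<open>ys ! 1 \<noteq> _\<close> by simp
qed

text \<open>Otherwise one could delete \<open>k\<close> vertices other than \<open>v\<close>, among
  them as many neighbours of \<open>v\<close> as possible, and leave \<open>v\<close> at most one
  neighbour, although \<open>v\<close> lies on a spanning cycle of the rest.\<close>

lemma min_degree:
  assumes "v \<in> V"
  shows "k + 2 \<le> card {w. E v w}"
proof (rule ccontr)
  let ?N = "{w. E v w}"
  assume "\<not> ?thesis"
  then have less: "card ?N \<le> k + 1"
    by simp
  obtain T where T: "T \<subseteq> ?N" "card T = min k (card ?N)"
    by (metis min.cobounded2 obtain_subset_with_card_n)
  have "finite T"
    using T(1) finite_nbrs finite_subset by blast
  have "T \<subseteq> V - {v}"
    using T(1) irrefl sym in_V by blast
  moreover have "k \<le> card (V - {v})"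
    using card_V_ge assms finite_V by simp
  moreover have "card T \<le> k"
    using T(2) by simp
  ultimately obtain R where R: "T \<subseteq> R" "R \<subseteq> V - {v}" "card R = k"
    using exists_subset_between[of T k "V - {v}"] finite_V by auto
  then obtain xs where xs: "vertex_cycle E xs" "set xs = V - R"
    using obtain_cycle[of R] by blast
  have "2 \<le> card (?N \<inter> set xs)"
    using cycle_two_nbrs[OF xs(1), of v] xs(2) assms R(2) by auto
  also have "\<dots> \<le> card (?N - T)"
    using finite_nbrs xs(2) R(1) by (intro card_mono) auto
  also have "\<dots> \<le> 1"
    using T less \<open>finite T\<close> by (simp add: card_Diff_subset)
  finally show False
    by simp
qed

section \<open>Induced paths\<close>

definition induced_path :: "'a list \<Rightarrow> bool" where
  "induced_path ps \<longleftrightarrow> distinct ps \<and> set ps \<subseteq> V \<and>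
     (\<forall>i < length ps. \<forall>j < length ps. E (ps ! i) (ps ! j) \<longleftrightarrow> i = Suc j \<or> j = Suc i)"

lemma induced_path_successively: "induced_path ps \<Longrightarrow> successively E ps"
  by (auto simp: induced_path_def successively_conv_nth)

lemma induced_path_Cons:
  assumes ps: "induced_path (x # qs)" and u: "E u x" "u \<notin> set (x # qs)"
    and nonadj: "\<And>i. i < length qs \<Longrightarrow> \<not> E u (qs ! i)"
  shows "induced_path (u # x # qs)"
proof -
  have nadj: "\<not> E (qs ! i) u" if "i < length qs" for i
    using nonadj[OF that] sym by blast
  have adj: "E ((x # qs) ! i) ((x # qs) ! j) \<longleftrightarrow> i = Suc j \<or> j = Suc i"
    if "i < Suc (length qs)" "j < Suc (length qs)" for i j
    using ps that unfolding induced_path_def by simp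
  have "E ((u # x # qs) ! i) ((u # x # qs) ! j) \<longleftrightarrow> i = Suc j \<or> j = Suc i"
    if "i < length (u # x # qs)" "j < length (u # x # qs)" for i j
  proof (cases i)
    case 0
    then show ?thesis
      using that u(1) irrefl nonadj by (cases j; cases "j - 1") auto
  next
    case (Suc i')
    show ?thesis
    proof (cases j)
      case 0
      then show ?thesis
        using that u(1) irrefl nadj Suc sym by (cases i') auto
    next
      case (Suc j')
      then show ?thesis
        using adj[of i' j'] that \<open>i = Suc i'\<close> by simp
    qed
  qed
  then show ?thesis
    using ps u in_V unfolding induced_path_def by auto
qed

text \<open>
  Delete a \<open>k\<close>-set that contains the path except for its first vertex \<open>x\<close>. A successor of \<open>x\<close> on a
  spanning cycle of the rest has no neighbour on the deleted part of the path, since otherwise a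
  detour along the path would lengthen the cycle.
\<close>

lemma induced_path_extend:
  assumes ps: "induced_path (x # qs)" and len: "length qs \<le> k"
  obtains u where "induced_path (u # x # qs)"
proof -
  have qs: "distinct qs" "set qs \<subseteq> V - {x}" "x \<in> V" "successively E (x # qs)"
    using ps induced_path_successively by (auto simp: induced_path_def)
  have "card (set qs) \<le> k"
    using qs(1) len by (simp add: distinct_card)
  moreover have "k \<le> card (V - {x})"
    using card_V_ge qs(3) finite_V by simp
  ultimately obtain R where R: "set qs \<subseteq> R" "R \<subseteq> V - {x}" "card R = k"
    using exists_subset_between[of "set qs" k "V - {x}"] finite_V qs(2) by auto
  then obtain xs where xs: "vertex_cycle E xs" "set xs = V - R" "length xs + k = card V"
    using obtain_cycle[of R] by blast
  have "x \<in> set xs"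
    using xs(2) R(2) qs(3) by blast
  then obtain t where t: "t < length xs" "xs ! t = x" "E x (xs ! ((t + 1) mod length xs))"
    using cycle_succ[OF xs(1)] by blast
  define u where "u = xs ! ((t + 1) mod length xs)"
  have "1 < length xs"
    using xs(1) by (simp add: vertex_cycle_def)
  have "u \<in> set xs"
    unfolding u_def by (intro nth_mem mod_less_divisor) (use t(1) in linarith)
  then have "u \<notin> set (x # qs)"
    using xs(2) R(1) t(3) irrefl u_def by auto
  moreover have "\<not> E u (qs ! i)" if i: "i < length qs" for i
  proof
    assume "E u (qs ! i)"
    \<comment> \<open>\<open>?Q\<close> leads from a neighbour of \<open>x\<close> to a neighbour of
      \<open>u\<close>, so it could replace the edge \<open>x u\<close>, an arc of length 1.\<close>
    let ?Q = "take (Suc i) qs"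
    have "successively E qs"
      using qs(4) by (auto simp: successively_Cons)
    then have "successively E (?Q @ drop (Suc i) qs)"
      by simp
    then have "successively E ?Q"
      unfolding successively_append_iff by blast
    moreover have "last ?Q = qs ! i"
      using i by (simp add: take_Suc_conv_app_nth)
    moreover have "E x (hd ?Q)"
      using qs(4) i by (auto simp: successively_Cons)
    moreover have "set ?Q \<inter> set xs = {}"
      using set_take_subset[of "Suc i" qs] R(1) xs(2) by blast
    ultimately have "length ?Q + 1 \<le> 1"
      using i qs(1) t \<open>E u (qs ! i)\<close> sym \<open>1 < length xs\<close>
      by (intro shortcut[OF xs(1,3), of ?Q t]) (auto simp: u_def)
    then show False
      using i by simp
  qed
  ultimately have "induced_path (u # x # qs)"
    using ps t(3) sym by (intro induced_path_Cons) (auto simp: u_def)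
  then show thesis
    by (rule that)
qed

lemma induced_path_exists: "j \<le> k \<Longrightarrow> \<exists>ps. induced_path ps \<and> length ps = Suc j"
proof (induction j)
  case 0
  obtain v where "v \<in> V"
    using card_V_ge by fastforce
  then show ?case
    using irrefl by (intro exI[of _ "[v]"]) (auto simp: induced_path_def)
next
  case (Suc j)
  then obtain ps where ps: "induced_path ps" "length ps = Suc j"
    by auto
  then obtain x qs where "ps = x # qs"
    by (cases ps) auto
  then show ?case
    using induced_path_extend[of x qs] ps Suc.prems by (metis Suc_leD length_Cons nat.inject)
qed

section \<open>Packing the neighbours of the path along the cycle\<close>

text \<open>The subpath between the two path vertices has |i - j| + 1 vertices and is a detour
  around an arc of length \<open>d\<close>, so \<open>shortcut\<close> applies. Two inequalities
  avoid truncated subtraction.\<close>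

lemma label_gap:
  assumes ps: "induced_path ps" and xs: "vertex_cycle E xs" "length xs + k = card V"
    and disj: "set ps \<inter> set xs = {}"
    and ij: "i < length ps" "j < length ps"
    and t: "t < length xs" and d: "0 < d" "d < length xs"
    and adj: "E (xs ! t) (ps ! i)" "E (xs ! ((t + d) mod length xs)) (ps ! j)"
  shows "i + 2 \<le> j + d" "j + 2 \<le> i + d"
proof -
  have sub: "b - a + 2 \<le> d" if "a \<le> b" "b < length ps" "{a, b} = {i, j}" for a b
  proof -
    define P where "P = take (Suc (b - a)) (drop a ps)"
    have len: "length P = Suc (b - a)"
      using that by (simp add: P_def)
    have hd: "hd P = ps ! a"
      using that by (simp add: P_def hd_drop_conv_nth)
    have "last P = ps ! b"
      using that len by (simp add: last_conv_nth P_def)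
    have set_P: "set P \<inter> set xs = {}"
      using disj set_take_subset[of "Suc (b - a)" "drop a ps"] set_drop_subset[of a ps]
      unfolding P_def by blast
    have "distinct P"
      using ps by (simp add: P_def induced_path_def)
    have "successively E (take a ps @ drop a ps)"
      using induced_path_successively[OF ps] by simp
    then have "successively E (drop a ps)"
      unfolding successively_append_iff by blast
    then have "successively E (P @ drop (Suc (b - a)) (drop a ps))"
      unfolding P_def append_take_drop_id .
    then have succ: "successively E P"
      unfolding successively_append_iff by blast
    have "P \<noteq> []"
      using len by auto
    show ?thesis
    proof (cases "a = i \<and> b = j")
      case True
      have "length P + 1 \<le> d"
        using True hd \<open>last P = _\<close> set_P \<open>distinct P\<close> succ \<open>P \<noteq> []\<close> adj sym
        by (intro shortcut[OF xs _ _ _ _ t d]) auto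
      then show ?thesis
        using len by simp
    next
      case False
      then have "a = j" "b = i"
        using that(3) by (auto simp: doubleton_eq_iff)
      \<comment> \<open>Here the detour starts at the larger label, so the subpath is traversed
        backwards.\<close>
      have "successively (\<lambda>x y. E y x) P"
        using succ sym by (metis successively_mono)
      then have "length (rev P) + 1 \<le> d"
        using \<open>a = j\<close> \<open>b = i\<close> hd \<open>last P = _\<close> set_P \<open>distinct P\<close> \<open>P \<noteq> []\<close> adj sym
        by (intro shortcut[OF xs _ _ _ _ t d]) (auto simp: hd_rev last_rev)
      then show ?thesis
        using len by simp
    qed
  qed
  show "i + 2 \<le> j + d" "j + 2 \<le> i + d"
    using sub[of i j] sub[of j i] ij by (cases "i \<le> j"; force)+
qed

text \<open>
  Each neighbour \<open>xs ! t\<close> of the path with label set \<open>L t\<close> (the indices of its neighbours on the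
  path) claims the positions \<open>t + i\<close>, \<open>i \<in> L t\<close>, and \<open>t + Max (L t) + 1\<close> of the cycle. No two
  claims collide, because labels \<open>i\<close> and \<open>j\<close> occur at distance at least \<open>\<bar>i - j\<bar> + 2\<close>.
\<close>

lemma cycle_length_ge:
  assumes ps: "induced_path ps" and xs: "vertex_cycle E xs" "length xs + k = card V"
    and disj: "set ps \<inter> set xs = {}" and long: "length ps < length xs"
  shows "(\<Sum>i<length ps. card {t. t < length xs \<and> E (xs ! t) (ps ! i)})
     + card {t. t < length xs \<and> (\<exists>i<length ps. E (xs ! t) (ps ! i))} \<le> length xs"
proof -
  define N where "N = length xs"
  define m where "m = length ps"
  define L where "L t = {i. i < m \<and> E (xs ! t) (ps ! i)}" for t
  define M where "M = {t. t < N \<and> L t \<noteq> {}}"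
  \<comment> \<open>\<open>T\<close> holds the claims \<open>t + i\<close>, one per edge between
    path and cycle; \<open>S\<close> holds the additional claims, one per cycle vertex with a
    neighbour on the path.\<close>
  define T where "T = (SIGMA t:{..<N}. L t)"
  define S where "S = (\<lambda>t. (t, Suc (Max (L t)))) ` M"
  have finite_L: "finite (L t)" for t
    by (simp add: L_def)
  have claim: "t < N \<and> (\<exists>a \<in> L t. i = a \<or> i = Suc a)" if "(t, i) \<in> T \<union> S" for t i
    using that Max_in[OF finite_L] by (fastforce simp: T_def S_def M_def)
  have collision: "t = t' \<and> i = i'"
    if ti: "(t, i) \<in> T \<union> S" and ti': "(t', i') \<in> T \<union> S" and le: "i \<le> i'"
      and eq: "(t + i) mod N = (t' + i') mod N" for t i t' i'
  proof -
    obtain a where a: "t < N" "a \<in> L t" "i = a \<or> i = Suc a"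
      using claim[OF ti] by blast
    obtain b where b: "t' < N" "b \<in> L t'" "i' = b \<or> i' = Suc b"
      using claim[OF ti'] by blast
    define d where "d = i' - i"
    \<comment> \<open>A claimed offset is at most \<open>length ps\<close>, hence below the cycle
      length.\<close>
    have "d < N"
      using b long le by (auto simp: d_def L_def N_def m_def)
    have "(t' + d + i) mod N = (t + i) mod N"
      using eq le by (simp add: d_def)
    then have "[t' + d + i = t + i] (mod N)"
      by (simp add: cong_def)
    then have "[t' + d = t] (mod N)"
      by (simp only: cong_add_rcancel_nat)
    then have t: "t = (t' + d) mod N"
      using a(1) by (simp add: cong_def)
    show ?thesis
    proof (cases "d = 0")
      case True
      then show ?thesis
        using t b(1) le by (simp add: d_def)
    next
      case False
      \<comment> \<open>This contradicts \<open>a + d \<le> b + 1\<close>, which follows from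
        \<open>a \<le> i\<close>, \<open>i + d = i'\<close> and
        \<open>i' \<le> b + 1\<close>.\<close>
      then have "b + 2 \<le> a + d"
        using label_gap(1)[OF ps xs disj, of b a t' d] a b \<open>d < N\<close> t
        by (auto simp: L_def N_def m_def)
      then show ?thesis
        using a(3) b(3) le by (auto simp: d_def)
    qed
  qed
  have "inj_on (\<lambda>(t, i). (t + i) mod N) (T \<union> S)"
  proof (rule inj_onI, clarify)
    fix t i t' i'
    assume "(t, i) \<in> T \<union> S" "(t', i') \<in> T \<union> S" "(t + i) mod N = (t' + i') mod N"
    then show "t = t' \<and> i = i'"
      using collision[of t i t' i'] collision[of t' i' t i] by (cases "i \<le> i'") auto
  qed
  moreover have "(\<lambda>(t, i). (t + i) mod N) ` (T \<union> S) \<subseteq> {..<N}"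
    using long by (cases "xs = []") (auto simp: N_def)
  ultimately have "card (T \<union> S) \<le> N"
    using card_inj_on_le[of _ "T \<union> S" "{..<N}"] by simp
  moreover have "finite T" "finite S"
    by (auto simp: T_def S_def M_def finite_L)
  moreover have "T \<inter> S = {}"
  proof -
    have "Suc (Max (L t)) \<notin> L t" for t
      using Max_ge[OF finite_L, of "Suc (Max (L t))" t] by auto
    then show ?thesis
      by (auto simp: T_def S_def)
  qed
  ultimately have "card T + card S \<le> N"
    by (simp add: card_Un_disjoint)
  moreover have "card S = card M"
    unfolding S_def by (rule card_image) (auto simp: inj_on_def)
  moreover have "M = {t. t < length xs \<and> (\<exists>i<length ps. E (xs ! t) (ps ! i))}"
    by (auto simp: M_def L_def N_def m_def)
  \<comment> \<open>The edges between path and cycle are now counted from the path side.\<close>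
  moreover have "card T = (\<Sum>i<m. card {t. t < N \<and> E (xs ! t) (ps ! i)})"
  proof -
    have "card T = card (prod.swap ` T)"
      by (simp add: card_image)
    also have "prod.swap ` T = (SIGMA i:{..<m}. {t. t < N \<and> E (xs ! t) (ps ! i)})"
      by (auto simp: T_def L_def)
    finally show ?thesis
      by simp
  qed
  ultimately show ?thesis
    by (simp add: N_def m_def)
qed

section \<open>Degree count and the bound on the order\<close>

theorem order_ge: "k\<^sup>2 + 2 * k + 3 \<le> card V"
proof -
  obtain j where k: "k = Suc j"
    using k_pos gr0_implies_Suc by blast
  obtain ps where ps: "induced_path ps" "length ps = k"
    using induced_path_exists[of j] k by auto
  have "set ps \<subseteq> V" "card (set ps) = k"
    using ps by (auto simp: induced_path_def distinct_card)
  then obtain xs where xs: "vertex_cycle E xs" "set xs = V - set ps" "length xs + k = card V"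
    using obtain_cycle by metis
  have disj: "set ps \<inter> set xs = {}"
    using xs(2) by blast
  \<comment> \<open>The neighbours of \<open>ps ! i\<close> are split by position:
    \<open>A i\<close> on the cycle, \<open>B i\<close> on the path.\<close>
  define A where "A i = {t. t < length xs \<and> E (xs ! t) (ps ! i)}" for i
  define B where "B i = {l. l < k \<and> (i = Suc l \<or> l = Suc i)}" for i
  have deg: "k + 2 \<le> card (A i) + card (B i)" if i: "i < k" for i
  proof -
    let ?v = "ps ! i"
    have "?v \<in> V"
      using i ps(2) \<open>set ps \<subseteq> V\<close> nth_mem by blast
    have "{w. E ?v w} \<subseteq> (\<lambda>t. xs ! t) ` A i \<union> (\<lambda>l. ps ! l) ` B i"
    proof
      fix w
      assume w: "w \<in> {w. E ?v w}"
      then have "w \<in> V"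
        using sym in_V by blast
      then consider t where "t < length xs" "w = xs ! t" | l where "l < k" "w = ps ! l"
        using xs(2) ps(2) by (metis DiffI in_set_conv_nth)
      then show "w \<in> (\<lambda>t. xs ! t) ` A i \<union> (\<lambda>l. ps ! l) ` B i"
      proof cases
        case 1
        then show ?thesis
          using w sym by (auto simp: A_def)
      next
        case 2
        then show ?thesis
          using w i ps by (auto simp: B_def induced_path_def)
      qed
    qed
    then have "card {w. E ?v w} \<le> card ((\<lambda>t. xs ! t) ` A i \<union> (\<lambda>l. ps ! l) ` B i)"
      by (intro card_mono) (auto simp: A_def B_def)
    also have "\<dots> \<le> card ((\<lambda>t. xs ! t) ` A i) + card ((\<lambda>l. ps ! l) ` B i)"
      by (rule card_Un_le)
    also have "\<dots> \<le> card (A i) + card (B i)"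
      by (intro add_mono card_image_le) (auto simp: A_def B_def)
    finally show ?thesis
      using min_degree[OF \<open>?v \<in> V\<close>] by simp
  qed
  \<comment> \<open>The end \<open>ps ! 0\<close> has at most one neighbour on the path, hence at
    least \<open>k + 1\<close> on the cycle. This bounds the number of claims in \<open>S\<close>
    from below and also makes the cycle longer than the path.\<close>
  have "card (B 0) \<le> card {1 :: nat}"
    by (intro card_mono) (auto simp: B_def)
  then have A0: "k + 1 \<le> card (A 0)"
    using deg[of 0] k_pos by simp
  have "card (A 0) \<le> card {..<length xs}"
    by (intro card_mono) (auto simp: A_def)
  then have "(\<Sum>i<k. card (A i)) + card {t. t < length xs \<and> (\<exists>i<k. E (xs ! t) (ps ! i))}
      \<le> length xs"
    using cycle_length_ge[OF ps(1) xs(1,3) disj] A0 ps(2) by (simp add: A_def)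
  moreover have "card (A 0) \<le> card {t. t < length xs \<and> (\<exists>i<k. E (xs ! t) (ps ! i))}"
    using k_pos by (intro card_mono) (auto simp: A_def)
  moreover have "k * (k + 2) \<le> (\<Sum>i<k. card (A i)) + (\<Sum>i<k. card (B i))"
    using sum_mono[of "{..<k}" "\<lambda>_. k + 2" "\<lambda>i. card (A i) + card (B i)"] deg
    by (simp add: sum.distrib)
  moreover have "(\<Sum>i<k. card (B i)) = 2 * j"
    using sum_path_degrees[of j] by (simp add: B_def k)
  \<comment> \<open>Since \<open>j = k - 1\<close>, the right side is
    \<open>card V + 2 * k - 2\<close>.\<close>
  ultimately have "k * (k + 2) + (k + 1) + k \<le> card V + 2 * j"
    using A0 xs(3) by linarith
  then show ?thesis
    by (simp add: k power2_eq_square algebra_simps)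
qed

end

section \<open>Transfer to the graph class\<close>

theorem theorem1p3:
  fixes n k :: nat
  assumes "n > 0" and "k > 0"
    and "n < k ^ 2 + 2 * k + 3"
  shows "(Gamma_class n k :: 'a pair_pre_digraph set) = {}"
proof (rule ccontr)
  assume "\<not> ?thesis"
  then obtain G :: "'a pair_pre_digraph" where "pair_graph G" and n: "card (pverts G) = n"
    and circ: "circumference (with_proj G) + k = n"
    and ham: "\<And>U. U \<subseteq> pverts G \<Longrightarrow> card U + k = n \<Longrightarrow> hamiltonian (with_proj G \<restriction> U)"
    unfolding Gamma_class_def by blast
  interpret pair_graph G
    by fact
  interpret deletion_hamiltonian "pverts G" "\<lambda>x y. (x, y) \<in> parcs G" k
  proof
    show "(y, x) \<in> parcs G" if "(x, y) \<in> parcs G" for x y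
      using that pair_sym_arcs by (auto simp: symmetric_def elim: symE)
    show "(x, x) \<notin> parcs G" for x
      using pair_no_loops[of "(x, x)"] by auto
    show "x \<in> pverts G" if "(x, y) \<in> parcs G" for x y
      using arc_fst_in_verts[OF that] by simp
    show "length xs + k \<le> card (pverts G)" if "vertex_cycle (\<lambda>x y. (x, y) \<in> parcs G) xs" for xs
      using vertex_cycle_le_circumference[OF that] circ n by simp
    fix R
    assume R: "R \<subseteq> pverts G" "card R = k"
    have "finite R"
      using R(1) pair_finite_verts finite_subset by blast
    then have "card (pverts G - R) + k = n"
      using R circ n by (simp add: card_Diff_subset)
    then have "hamiltonian (with_proj G \<restriction> (pverts G - R))"
      by (intro ham) auto
    then show "\<exists>xs. vertex_cycle (\<lambda>x y. (x, y) \<in> parcs G) xs \<and> set xs = pverts G - R"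
      unfolding hamiltonian_def by (metis graph_cycle_imp_vertex_cycle induce_subgraph_verts)
  \<comment> \<open>The additive form of the circumference equation yields
    \<open>k \<le> n\<close>.\<close>
  qed (use pair_finite_verts assms(2) circ n in auto)
  show False
    using order_ge n assms(3) by simp
qed

end
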